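(* If $X,Y,Z,\pi$ is the data of a gated decomposition of a betweenness space $X$, then the inclusion $\mathrm{MC}_*(Y,Z)\hookrightarrow\mathrm{MC}_*(X)$ is a quasi-isomorphism.
   Context: A betweenness space is a set $X$ with a map $[\cdot,\cdot]:X\times X\to\mathcal P(X)$ such that: (B1) $x,z\in[x,z]$; (B2) $y\in[x,z]$ implies $[x,y]\subseteq[x,z]$ and $[y,z]\subseteq[x,z]$; (B3) if $w,y\in[x,z]$, then $w\in[x,y]$ iff $y\in[w,z]$. A subset of $X$ is a betweenness space with intervals intersected with the subset. A $k$-path in $X$ ($k\ge0$) is a tuple $\langle x_0,\dots,x_k\rangle$ with $x_i\ne x_{i+1}$ for all $i<k$. $\mathrm{MC}_k(X)$ is the free abelian group on $k$-paths, with boundary $\partial_k=\sum_{i=1}^{k-1}(-1)^i\partial_{k,i}$, where $\partial_{k,i}\langle x_0,\dots,x_k\rangle=\langle x_0,\dots,\widehat{x_i},\dots,x_k\rangle$ if $x_i\in[x_{i-1},x_{i+1}]$, and $0$ otherwise (a tuple with consecutive equal entries being read as $0$). For $X=Y\cup Z$, $\mathrm{MC}_*(Y,Z)$ is the subcomplex of $\mathrm{MC}_*(X)$ spanned by paths entirely contained in $Y$ or entirely contained in $Z$. Good sets: for a tuple $\mathbf x=\langle x_0,\dots,x_k\rangle$ let $d_i\mathbf x$ be the tuple with $x_i$ removed. For endpoint indices with $k\ge1$, "$x_i\in[x_{i-1},x_{i+1}]$" is read as $x_0=x_1$ when $i=0$, and as $x_{k-1}=x_k$ when $i=k$ (likewise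 for images under $f$). For a map $f:A\to B$ between betweenness spaces, a set $G$ of tuples ($k\ge0$, repetitions allowed) in $A$ is $f$-good if: (G1) for $\mathbf x\in G$ and each $i$: $fx_i\in[fx_{i-1},fx_{i+1}]$ iff ($x_i\in[x_{i-1},x_{i+1}]$ and $d_i\mathbf x\in G$); (G2) if $\mathbf x\notin G$ and $x_i\in[x_{i-1},x_{i+1}]$, then $d_i\mathbf x\notin G$. There is a maximal $f$-good set, denoted $\hat G(f)$ (the union of all $f$-good sets). A gated decomposition of $X$ consists of subsets $Y,Z$ of $X$ with $X=Y\cup Z$ and a map $\pi:Z\to Y\cap Z$ such that: for all $z\in Z$, $y\in Y$, $\pi(z)\in[z,y]$; $\pi|_{Y\cap Z}=\mathrm{Id}_{Y\cap Z}$; and $\hat G(\pi)$ contains all tuples of points of $Y\cap Z$.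
   Formalization: The formal theorem also assumes that MC_*(X) is a chain complex (B1–B3 alone do not give ∂²=0) and that π(z)∈[y,z] as well as π(z)∈[z,y] for y∈Y, z∈Z (automatic for symmetric intervals; without it the claim fails). *)

theory Defs
  imports "HOL-Algebra.Free_Abelian_Groups"
begin

section \<open>Betweenness spaces\<close>

locale betweenness_space =
  fixes X :: "'a set" and I :: "'a \<Rightarrow> 'a \<Rightarrow> 'a set"
  assumes interval_subset: "\<lbrakk>x \<in> X; z \<in> X\<rbrakk> \<Longrightarrow> I x z \<subseteq> X"
    and B1: "\<lbrakk>x \<in> X; z \<in> X\<rbrakk> \<Longrightarrow> x \<in> I x z \<and> z \<in> I x z"
    and B2: "\<lbrakk>x \<in> X; z \<in> X; y \<in> I x z\<rbrakk> \<Longrightarrow> I x y \<subseteq> I x z \<and> I y z \<subseteq> I x z"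
    and B3: "\<lbrakk>x \<in> X; z \<in> X; w \<in> I x z; y \<in> I x z\<rbrakk> \<Longrightarrow> w \<in> I x y \<longleftrightarrow> y \<in> I w z"

definition subspace_interval :: "('a \<Rightarrow> 'a \<Rightarrow> 'a set) \<Rightarrow> 'a set \<Rightarrow> 'a \<Rightarrow> 'a \<Rightarrow> 'a set" where
  "subspace_interval I A = (\<lambda>x z. I x z \<inter> A)"

definition delete_nth :: "nat \<Rightarrow> 'a list \<Rightarrow> 'a list" where
  "delete_nth i xs = take i xs @ drop (Suc i) xs"


section \<open>Chain complexes and quasi-isomorphisms\<close>

text \<open>A chain complex in degrees \<open>\<ge> 0\<close> is given by its groups \<open>C k\<close> and differentials
  \<open>d k : C k \<rightarrow> C (k - 1)\<close> for \<open>k \<ge> 1\<close>. The differential out of \<open>C 0\<close> is zero, so \<open>d 0\<close> is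
  irrelevant.\<close>

definition chain_complex :: "(nat \<Rightarrow> ('c, 'm) monoid_scheme) \<Rightarrow> (nat \<Rightarrow> 'c \<Rightarrow> 'c) \<Rightarrow> bool" where
  "chain_complex C d \<longleftrightarrow>
     (\<forall>k. comm_group (C k)) \<and>
     (\<forall>k. d (Suc k) \<in> hom (C (Suc k)) (C k)) \<and>
     (\<forall>k. \<forall>c \<in> carrier (C (Suc (Suc k))). d (Suc k) (d (Suc (Suc k)) c) = \<one>\<^bsub>C k\<^esub>)"

definition chain_map ::
  "(nat \<Rightarrow> ('c, 'm) monoid_scheme) \<Rightarrow> (nat \<Rightarrow> 'c \<Rightarrow> 'c) \<Rightarrow>
   (nat \<Rightarrow> ('e, 'n) monoid_scheme) \<Rightarrow> (nat \<Rightarrow> 'e \<Rightarrow> 'e) \<Rightarrow> (nat \<Rightarrow> 'c \<Rightarrow> 'e) \<Rightarrow> bool" where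
  "chain_map C d D e f \<longleftrightarrow>
     (\<forall>k. f k \<in> hom (C k) (D k)) \<and>
     (\<forall>k. \<forall>c \<in> carrier (C (Suc k)). f k (d (Suc k) c) = e (Suc k) (f (Suc k) c))"

definition cycles :: "(nat \<Rightarrow> ('c, 'm) monoid_scheme) \<Rightarrow> (nat \<Rightarrow> 'c \<Rightarrow> 'c) \<Rightarrow> nat \<Rightarrow> 'c set" where
  "cycles C d k = (case k of 0 \<Rightarrow> carrier (C 0) | Suc j \<Rightarrow> kernel (C (Suc j)) (C j) (d (Suc j)))"

definition boundaries :: "(nat \<Rightarrow> ('c, 'm) monoid_scheme) \<Rightarrow> (nat \<Rightarrow> 'c \<Rightarrow> 'c) \<Rightarrow> nat \<Rightarrow> 'c set" where
  "boundaries C d k = d (Suc k) ` carrier (C (Suc k))"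

definition homology :: "(nat \<Rightarrow> ('c, 'm) monoid_scheme) \<Rightarrow> (nat \<Rightarrow> 'c \<Rightarrow> 'c) \<Rightarrow> nat \<Rightarrow> 'c set monoid" where
  "homology C d k = (C k)\<lparr>carrier := cycles C d k\<rparr> Mod boundaries C d k"

text \<open>The map in degree \<open>k\<close> sending the class \<open>A\<close> of a cycle \<open>a\<close> to the class of \<open>f k a\<close>. For a
  chain map \<open>f\<close> the cosets in the union are all equal.\<close>

definition homology_map ::
  "(nat \<Rightarrow> ('e, 'n) monoid_scheme) \<Rightarrow> (nat \<Rightarrow> 'e \<Rightarrow> 'e) \<Rightarrow> (nat \<Rightarrow> 'c \<Rightarrow> 'e) \<Rightarrow> nat \<Rightarrow> 'c set \<Rightarrow> 'e set" where
  "homology_map D e f k A = (\<Union>a\<in>A. boundaries D e k #>\<^bsub>D k\<^esub> f k a)"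

definition quasi_isomorphism ::
  "(nat \<Rightarrow> ('c, 'm) monoid_scheme) \<Rightarrow> (nat \<Rightarrow> 'c \<Rightarrow> 'c) \<Rightarrow>
   (nat \<Rightarrow> ('e, 'n) monoid_scheme) \<Rightarrow> (nat \<Rightarrow> 'e \<Rightarrow> 'e) \<Rightarrow> (nat \<Rightarrow> 'c \<Rightarrow> 'e) \<Rightarrow> bool" where
  "quasi_isomorphism C d D e f \<longleftrightarrow>
     chain_complex C d \<and> chain_complex D e \<and> chain_map C d D e f \<and>
     (\<forall>k. homology_map D e f k \<in> iso (homology C d k) (homology D e k))"


section \<open>The magnitude chain complex\<close>

text \<open>A tuple \<open>\<langle>x\<^sub>0,\<dots>,x\<^sub>k\<rangle>\<close> is a list of length \<open>k + 1\<close>.\<close>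

definition k_paths :: "'a set \<Rightarrow> nat \<Rightarrow> 'a list set" where
  "k_paths X k = {xs. length xs = Suc k \<and> set xs \<subseteq> X \<and> (\<forall>i<k. xs ! i \<noteq> xs ! Suc i)}"

definition face :: "('a \<Rightarrow> 'a \<Rightarrow> 'a set) \<Rightarrow> nat \<Rightarrow> 'a list \<Rightarrow> 'a list \<Rightarrow>\<^sub>0 int" where
  "face I i xs =
     (if xs ! i \<in> I (xs ! (i - 1)) (xs ! (i + 1)) \<and> distinct_adj (delete_nth i xs)
      then frag_of (delete_nth i xs) else 0)"

definition boundary :: "('a \<Rightarrow> 'a \<Rightarrow> 'a set) \<Rightarrow> nat \<Rightarrow> ('a list \<Rightarrow>\<^sub>0 int) \<Rightarrow> ('a list \<Rightarrow>\<^sub>0 int)" where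
  "boundary I k = frag_extend (\<lambda>xs. \<Sum>i = 1..<k. frag_cmul ((-1) ^ i) (face I i xs))"

definition MC :: "'a set \<Rightarrow> nat \<Rightarrow> ('a list \<Rightarrow>\<^sub>0 int) monoid" where
  "MC X k = free_Abelian_group (k_paths X k)"

definition MC_pair :: "'a set \<Rightarrow> 'a set \<Rightarrow> nat \<Rightarrow> ('a list \<Rightarrow>\<^sub>0 int) monoid" where
  "MC_pair Y Z k = free_Abelian_group (k_paths Y k \<union> k_paths Z k)"


section \<open>Good sets and gated decompositions\<close>

definition tuples :: "'a set \<Rightarrow> 'a list set" where
  "tuples A = {xs. xs \<noteq> [] \<and> set xs \<subseteq> A}"

text \<open>The condition \<open>x\<^sub>i \<in> [x\<^sub>i\<^sub>-\<^sub>1, x\<^sub>i\<^sub>+\<^sub>1]\<close>, with its conventional reading at the two ends. It is only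
  meaningful, and only used, for tuples with at least two entries.\<close>

definition between_at :: "('a \<Rightarrow> 'a \<Rightarrow> 'a set) \<Rightarrow> 'a list \<Rightarrow> nat \<Rightarrow> bool" where
  "between_at I xs i \<longleftrightarrow>
     (if i = 0 then xs ! 0 = xs ! 1
      else if i = length xs - 1 then xs ! (i - 1) = xs ! i
      else xs ! i \<in> I (xs ! (i - 1)) (xs ! (i + 1)))"

text \<open>Here \<open>f\<close> is a map from the betweenness space \<open>(A, I)\<close> to one with intervals \<open>J\<close>.\<close>

definition good_set ::
  "'a set \<Rightarrow> ('a \<Rightarrow> 'a \<Rightarrow> 'a set) \<Rightarrow> ('b \<Rightarrow> 'b \<Rightarrow> 'b set) \<Rightarrow> ('a \<Rightarrow> 'b) \<Rightarrow> 'a list set \<Rightarrow> bool" where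
  "good_set A I J f G \<longleftrightarrow>
     G \<subseteq> tuples A \<and>
     (\<forall>xs \<in> G. length xs \<ge> 2 \<longrightarrow> (\<forall>i < length xs.
        between_at J (map f xs) i \<longleftrightarrow> between_at I xs i \<and> delete_nth i xs \<in> G)) \<and>
     (\<forall>xs \<in> tuples A - G. length xs \<ge> 2 \<longrightarrow> (\<forall>i < length xs.
        between_at I xs i \<longrightarrow> delete_nth i xs \<notin> G))"

definition max_good_set ::
  "'a set \<Rightarrow> ('a \<Rightarrow> 'a \<Rightarrow> 'a set) \<Rightarrow> ('b \<Rightarrow> 'b \<Rightarrow> 'b set) \<Rightarrow> ('a \<Rightarrow> 'b) \<Rightarrow> 'a list set" where
  "max_good_set A I J f = \<Union> {G. good_set A I J f G}"

definition gated_decomposition ::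
  "'a set \<Rightarrow> ('a \<Rightarrow> 'a \<Rightarrow> 'a set) \<Rightarrow> 'a set \<Rightarrow> 'a set \<Rightarrow> ('a \<Rightarrow> 'a) \<Rightarrow> bool" where
  "gated_decomposition X I Y Z \<pi> \<longleftrightarrow>
     X = Y \<union> Z \<and> \<pi> \<in> Z \<rightarrow> Y \<inter> Z \<and>
     (\<forall>z\<in>Z. \<forall>y\<in>Y. \<pi> z \<in> I z y) \<and>
     (\<forall>w \<in> Y \<inter> Z. \<pi> w = w) \<and>
     tuples (Y \<inter> Z) \<subseteq>
       max_good_set Z (subspace_interval I Z) (subspace_interval I (Y \<inter> Z)) \<pi>"


section \<open>When the magnitude chain complex is a complex\<close>

text \<open>B1 to B3 alone do not give \<open>\<partial>\<^sup>2 = 0\<close>: if all intervals of \<open>X = {a, x, b}\<close> equal \<open>X\<close>, then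
  \<open>\<partial>\<^sup>2 \<langle>a,x,a,b\<rangle> = - \<langle>a,b\<rangle>\<close>, as deleting \<open>x\<close> first produces a repetition and contributes 0. It
  suffices that the intervals \<open>[x,x]\<close> are trivial.\<close>

lemma delete_nth_nth:
  "i < length xs \<Longrightarrow> j < length xs - 1 \<Longrightarrow> delete_nth i xs ! j = (if j < i then xs ! j else xs ! Suc j)"
  by (auto simp: delete_nth_def nth_append)

lemma length_delete_nth [simp]: "i < length xs \<Longrightarrow> length (delete_nth i xs) = length xs - 1"
  by (simp add: delete_nth_def)

lemma set_delete_nth: "set (delete_nth i xs) \<subseteq> set xs"
  by (auto simp: delete_nth_def dest: in_set_takeD in_set_dropD)

lemma distinct_adj_delete_nth:
  assumes "distinct_adj xs" "0 < i" "Suc i < length xs"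
  shows "distinct_adj (delete_nth i xs) \<longleftrightarrow> xs ! (i - 1) \<noteq> xs ! Suc i"
proof
  assume "distinct_adj (delete_nth i xs)"
  then show "xs ! (i - 1) \<noteq> xs ! Suc i"
    using assms distinct_adj_nth[of "delete_nth i xs" "i - 1"]
    by (simp add: delete_nth_nth)
next
  assume "xs ! (i - 1) \<noteq> xs ! Suc i"
  then have "delete_nth i xs ! j \<noteq> delete_nth i xs ! Suc j" if "Suc j < length xs - 1" for j
    using assms that distinct_adj_nth[OF assms(1), of j] distinct_adj_nth[OF assms(1), of "Suc j"]
    by (cases "Suc j = i") (auto simp: delete_nth_nth)
  then show "distinct_adj (delete_nth i xs)"
    using assms by (simp add: distinct_adj_conv_nth)
qed

lemma k_paths_iff: "xs \<in> k_paths X k \<longleftrightarrow> length xs = Suc k \<and> set xs \<subseteq> X \<and> distinct_adj xs"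
  by (auto simp: k_paths_def distinct_adj_conv_nth)

lemma face_alt:
  assumes "xs \<in> k_paths X k" "0 < i" "i < k"
  shows "face I i xs = (if xs ! i \<in> I (xs ! (i - 1)) (xs ! Suc i) \<and> xs ! (i - 1) \<noteq> xs ! Suc i
      then frag_of (delete_nth i xs) else 0)"
  using assms distinct_adj_delete_nth[of xs i] by (auto simp: face_def k_paths_iff)

lemma delete_nth_k_paths:
  assumes "xs \<in> k_paths X (Suc k)" "0 < i" "i < Suc k" "xs ! (i - 1) \<noteq> xs ! Suc i"
  shows "delete_nth i xs \<in> k_paths X k"
  using assms distinct_adj_delete_nth[of xs i] set_delete_nth[of i xs]
  by (auto simp: k_paths_iff)

lemma delete_nth_commute:
  assumes "i \<le> j" "Suc j < length xs"
  shows "delete_nth i (delete_nth (Suc j) xs) = delete_nth j (delete_nth i xs)"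
  using assms by (intro nth_equalityI) (auto simp: delete_nth_nth)

context betweenness_space begin

lemma face_face:
  assumes T: "\<And>x. x \<in> X \<Longrightarrow> I x x = {x}"
    and xs: "xs \<in> k_paths X (Suc k)" and ij: "0 < i" "i \<le> j" "j < k"
  shows "frag_extend (face I i) (face I (Suc j) xs) = frag_extend (face I j) (face I i xs)"
proof -
  have len: "length xs = Suc (Suc k)" and sub: "set xs \<subseteq> X" and da: "distinct_adj xs"
    using xs by (auto simp: k_paths_iff)
  have inX: "xs ! l \<in> X" if "l < Suc (Suc k)" for l
    using that len sub nth_mem by auto
  let ?c = "\<lambda>l ys. ys ! l \<in> I (ys ! (l - 1)) (ys ! Suc l) \<and> ys ! (l - 1) \<noteq> ys ! Suc l"
  have L: "frag_extend (face I p) (face I q xs) =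
     (if ?c q xs \<and> ?c p (delete_nth q xs) then frag_of (delete_nth p (delete_nth q xs)) else 0)"
    if "0 < p" "p < k" "0 < q" "q < Suc k" for p q
    using that face_alt[OF xs, of q I] face_alt[OF delete_nth_k_paths[OF xs, of q], of p I] by auto
  have "?c (Suc j) xs \<and> ?c i (delete_nth (Suc j) xs) \<longleftrightarrow> ?c i xs \<and> ?c j (delete_nth i xs)"
  proof (cases "i = j")
    case False
    then show ?thesis using ij len by (auto simp: delete_nth_nth)
  next
    case True
    define a x y b where "a = xs ! (i - 1)" "x = xs ! i" "y = xs ! Suc i" "b = xs ! Suc (Suc i)"
    have X: "a \<in> X" "x \<in> X" "y \<in> X" "b \<in> X"
      using inX ij True by (auto simp: a_x_y_b_def)
    have ne: "a \<noteq> x" "x \<noteq> y" "y \<noteq> b"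
      using distinct_adj_nth[OF da, of "i - 1"] distinct_adj_nth[OF da, of i]
        distinct_adj_nth[OF da, of "Suc i"] ij len True
      by (auto simp: a_x_y_b_def)
    have "(y \<in> I x b \<and> x \<noteq> b) \<and> (x \<in> I a b \<and> a \<noteq> b) \<longleftrightarrow> (x \<in> I a y \<and> a \<noteq> y) \<and> (y \<in> I a b \<and> a \<noteq> b)"
      using B1[of a b] B2[of a b x] B2[of a b y] B3[of a b x y] T[of a] T[of b] X ne by blast
    then show ?thesis
      using ij len True by (auto simp: delete_nth_nth a_x_y_b_def)
  qed
  then show ?thesis
    using ij len by (simp add: L delete_nth_commute)
qed

lemma keys_face:
  assumes "xs \<in> k_paths X (Suc k)" "0 < i" "i < Suc k"
  shows "Poly_Mapping.keys (face I i xs) \<subseteq> k_paths X k"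
  using assms delete_nth_k_paths[OF assms] by (auto simp: face_alt[OF assms])

lemma keys_boundary:
  assumes "Poly_Mapping.keys c \<subseteq> k_paths X (Suc k)"
  shows "Poly_Mapping.keys (boundary I (Suc k) c) \<subseteq> k_paths X k"
proof -
  have "Poly_Mapping.keys (\<Sum>i = 1..<Suc k. frag_cmul ((-1) ^ i) (face I i xs)) \<subseteq> k_paths X k"
    if "xs \<in> k_paths X (Suc k)" for xs
  proof -
    have "Poly_Mapping.keys (frag_cmul ((-1) ^ i) (face I i xs)) \<subseteq> k_paths X k"
      if "i \<in> {1..<Suc k}" for i
      using keys_face[OF \<open>xs \<in> _\<close>, of i] that keys_cmul by fastforce
    then show ?thesis
      using keys_sum[of "\<lambda>i. frag_cmul ((-1) ^ i) (face I i xs)" "{1..<Suc k}"] by blast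
  qed
  then show ?thesis
    unfolding boundary_def
    using keys_frag_extend[of "\<lambda>xs. \<Sum>i = 1..<Suc k. frag_cmul ((-1) ^ i) (face I i xs)" c] assms
    by blast
qed

lemma boundary_boundary:
  assumes T: "\<And>x. x \<in> X \<Longrightarrow> I x x = {x}"
    and c: "Poly_Mapping.keys c \<subseteq> k_paths X (Suc k)"
  shows "boundary I k (boundary I (Suc k) c) = 0"
  using c
proof (induction rule: frag_induction)
  case (one xs)
  let ?g = "\<lambda>(j,i). frag_cmul ((-1) ^ (i + j)) (frag_extend (face I j) (face I i xs))"
  define A where "A = {(j,i). 0 < i \<and> i \<le> j \<and> j < k}"
  have fin: "finite A" by (rule finite_subset[of _ "{..<k} \<times> {..<k}"]) (auto simp: A_def)
  have split: "{1..<k} \<times> {1..<Suc k} = A \<union> (\<lambda>(j,i). (i, Suc j)) ` A"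
  proof (intro equalityI subsetI)
    fix p assume "p \<in> {1..<k} \<times> {1..<Suc k}"
    then obtain j i where p: "p = (j, i)" "0 < j" "j < k" "0 < i" "i < Suc k" by auto
    show "p \<in> A \<union> (\<lambda>(j,i). (i, Suc j)) ` A"
    proof (cases "i \<le> j")
      case False
      with p show ?thesis by (intro UnI2 image_eqI[of _ _ "(i - 1, j)"]) (auto simp: A_def)
    qed (use p in \<open>auto simp: A_def\<close>)
  qed (auto simp: A_def)
  have disj: "A \<inter> (\<lambda>(j,i). (i, Suc j)) ` A = {}" by (auto simp: A_def)
  have inj: "inj_on (\<lambda>(j,i). (i, Suc j)) A" by (auto simp: inj_on_def)
  have ext: "boundary I k c = (\<Sum>j = 1..<k. frag_cmul ((-1) ^ j) (frag_extend (face I j) c))" for c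
    by (simp add: boundary_def frag_extend_def frag_cmul_sum sum.swap[of _ "Poly_Mapping.keys c"] mult.commute)
  have "boundary I k (boundary I (Suc k) (frag_of xs)) = (\<Sum>p \<in> {1..<k} \<times> {1..<Suc k}. ?g p)"
  proof -
    have "boundary I (Suc k) (frag_of xs) = (\<Sum>i = 1..<Suc k. frag_cmul ((-1) ^ i) (face I i xs))"
      by (simp add: boundary_def)
    then show ?thesis
      by (simp add: ext frag_extend_sum frag_extend_cmul frag_cmul_sum sum.cartesian_product
          o_def power_add mult.commute del: sum.op_ivl_Suc)
  qed
  also have "\<dots> = sum ?g A + sum ?g ((\<lambda>(j,i). (i, Suc j)) ` A)"
    unfolding split by (rule sum.union_disjoint[OF fin finite_imageI[OF fin] disj])
  also have "sum ?g ((\<lambda>(j,i). (i, Suc j)) ` A) = (\<Sum>p\<in>A. - ?g p)"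
    unfolding sum.reindex[OF inj]
    by (rule sum.cong) (use face_face[OF T one] in \<open>auto simp: A_def add.commute\<close>)
  finally show ?case by (simp add: sum_negf)
next
  case (diff a b)
  then show ?case by (simp add: boundary_def frag_extend_diff)
qed (simp add: boundary_def)

lemma chain_complex_MC:
  assumes "\<And>x. x \<in> X \<Longrightarrow> I x x = {x}"
  shows "chain_complex (MC X) (boundary I)"
proof -
  have "boundary I k (a + b) = boundary I k a + boundary I k b" for k a b
    by (simp add: boundary_def frag_extend_add)
  then show ?thesis
    using keys_boundary boundary_boundary[OF assms]
    by (auto simp: chain_complex_def MC_def abelian_free_Abelian_group hom_def)
qed

end

end

theory Submission
  imports Defs
begin

text \<open>Call a path mixed if it has a point in \<open>Y - Z\<close> and a point in \<open>Z - Y\<close>. The quotient of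
  \<open>MC X\<close> by \<open>MC_pair Y Z\<close> is free on the mixed paths, and the inclusion is a quasi-isomorphism as
  soon as this quotient is acyclic. Without forming the quotient, acyclicity says: a chain of
  \<open>MC X\<close> whose boundary lies in \<open>MC_pair Y Z\<close> is itself the sum of a boundary and of a chain of
  \<open>MC_pair Y Z\<close>. This is \<open>unmixed_modulo_boundary\<close>, and \<open>inclusion_quasi_isomorphism\<close> draws
  the conclusion about homology.

  Acyclicity comes from a pairing of the mixed paths in the style of discrete Morse theory. Ignoring
  points of \<open>Y \<inter> Z\<close>, a mixed path has a first place where it changes between \<open>Y - Z\<close> and
  \<open>Z - Y\<close>. One of the two points at this crossing is some \<open>z \<in> Z - Y\<close>, and its neighbour on the
  side of the crossing lies in \<open>Y\<close>. The gate \<open>\<pi> z\<close> is therefore between \<open>z\<close> and that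
  neighbour: inserting it there produces a path that has the original one as a face. So the mixed
  paths without the gate at this place (the sources) correspond to those that already have it
  (the targets).

  The boundary is triangular with respect to this pairing and to the number of points outside
  \<open>Y \<inter> Z\<close>. Deleting such a point from a target lowers this number. Deleting a point of \<open>Y \<inter> Z\<close>
  other than the gate moves neither the crossing nor the gate, so the result is again a target
  (\<open>face_of_target\<close>). Hence the boundary of the target paired with the source \<open>x\<close> is \<open>\<plusminus>x\<close>, plus
  sources with fewer points outside \<open>Y \<inter> Z\<close>, plus targets and paths that are not mixed. By this
  triangularity the sources can be removed from a chain by subtracting boundaries
  (\<open>cancelling_pairs_clear_sources\<close>). If the boundary of the remaining chain has no mixed part,
  no target can be left in it either (\<open>cancelling_pairs_no_targets\<close>), because a target
  of maximal rank would contribute its source to the boundary.\<close>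

section \<open>Subcomplexes with acyclic quotient\<close>

lemma cycles_subgroup:
  assumes "chain_complex C d"
  shows "subgroup (cycles C d k) (C k)"
proof (cases k)
  case 0
  then show ?thesis
    using assms by (auto simp: cycles_def chain_complex_def comm_group_def group.subgroup_self)
next
  case (Suc j)
  interpret group_hom "C (Suc j)" "C j" "d (Suc j)"
    using assms by (auto simp: chain_complex_def comm_group_def group_hom_def group_hom_axioms_def)
  show ?thesis
    using subgroup_kernel by (simp add: cycles_def Suc)
qed

lemma boundaries_subgroup:
  assumes "chain_complex C d"
  shows "subgroup (boundaries C d k) (C k)"
proof -
  interpret group_hom "C (Suc k)" "C k" "d (Suc k)"
    using assms by (auto simp: chain_complex_def comm_group_def group_hom_def group_hom_axioms_def)
  show ?thesis
    using img_is_subgroup by (simp add: boundaries_def)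
qed

lemma boundaries_subset_cycles:
  assumes "chain_complex C d"
  shows "boundaries C d k \<subseteq> cycles C d k"
  using assms
  by (cases k) (auto simp: cycles_def boundaries_def chain_complex_def kernel_def hom_def Pi_iff)

lemma boundaries_normal_cycles:
  assumes C: "chain_complex C d"
  shows "boundaries C d k \<lhd> (C k)\<lparr>carrier := cycles C d k\<rparr>"
proof -
  interpret comm_group "C k" using C by (simp add: chain_complex_def)
  show ?thesis
    using normal_restrict_supergroup[OF cycles_subgroup[OF C] _ boundaries_subset_cycles[OF C]]
      boundaries_subgroup[OF C] normal_iff_subgroup by blast
qed

text \<open>The hypothesis \<open>absorb\<close> is the acyclicity of the quotient by the subcomplex \<open>S\<close>. Applied to a
  cycle it gives surjectivity on homology. For injectivity it is applied one degree higher, to a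
  chain \<open>e\<close> with \<open>d e \<in> S\<close>: then \<open>d e\<close> is the boundary of the part of \<open>e\<close> in \<open>S\<close>.\<close>

lemma inclusion_quasi_isomorphism:
  assumes D: "chain_complex D d"
    and S: "\<And>k. subgroup (S k) (D k)"
    and dS: "\<And>k c. c \<in> S (Suc k) \<Longrightarrow> d (Suc k) c \<in> S k"
    and absorb: "\<And>k e. \<lbrakk>e \<in> carrier (D k); k = 0 \<or> d k e \<in> S (k - 1)\<rbrakk>
      \<Longrightarrow> \<exists>g \<in> carrier (D (Suc k)). \<exists>m \<in> S k. e = d (Suc k) g \<otimes>\<^bsub>D k\<^esub> m"
  shows "quasi_isomorphism (\<lambda>k. (D k)\<lparr>carrier := S k\<rparr>) d D d (\<lambda>k c. c)"
proof -
  let ?C = "\<lambda>k. (D k)\<lparr>carrier := S k\<rparr>"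
  have grp: "comm_group (D k)" and hom: "d (Suc k) \<in> hom (D (Suc k)) (D k)"
    and dd: "c \<in> carrier (D (Suc (Suc k))) \<Longrightarrow> d (Suc k) (d (Suc (Suc k)) c) = \<one>\<^bsub>D k\<^esub>" for k c
    using D by (auto simp: chain_complex_def)
  have SD: "c \<in> carrier (D k)" if "c \<in> S k" for c k
    using subgroup.mem_carrier[OF S that] .
  have d_mult: "d (Suc k) (a \<otimes>\<^bsub>D (Suc k)\<^esub> b) = d (Suc k) a \<otimes>\<^bsub>D k\<^esub> d (Suc k) b"
    if "a \<in> carrier (D (Suc k))" "b \<in> carrier (D (Suc k))" for k a b
    using hom that by (auto simp: hom_def)
  have d_absorb: "d (Suc k) (d (Suc (Suc k)) g \<otimes>\<^bsub>D (Suc k)\<^esub> m) = d (Suc k) m"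
    if "g \<in> carrier (D (Suc (Suc k)))" "m \<in> S (Suc k)" for g m k
  proof -
    interpret comm_group "D k" by (rule grp)
    have "d (Suc k) m \<in> carrier (D k)" "d (Suc (Suc k)) g \<in> carrier (D (Suc k))"
      using that hom SD by (auto simp: hom_def Pi_iff)
    then show ?thesis using that by (simp add: d_mult dd SD)
  qed
  have C: "chain_complex ?C d"
    unfolding chain_complex_def
  proof (intro conjI allI ballI)
    fix k
    interpret comm_group "D k" by (rule grp)
    show "comm_group (?C k)"
      using subgroup_imp_group[OF S] SD by (intro group.group_comm_groupI) (auto simp: m_comm)
    show "d (Suc k) \<in> hom (?C (Suc k)) (?C k)"
      using d_mult dS SD by (auto simp: hom_def)
    fix c assume "c \<in> carrier (?C (Suc (Suc k)))"
    then show "d (Suc k) (d (Suc (Suc k)) c) = \<one>\<^bsub>?C k\<^esub>" using dd SD by simp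
  qed
  have "homology_map D d (\<lambda>k c. c) k \<in> iso (homology ?C d k) (homology D d k)" for k
  proof -
    interpret Dk: comm_group "D k" by (rule grp)
    have CD: "cycles ?C d k = cycles D d k \<inter> S k"
      by (cases k) (auto simp: cycles_def kernel_def SD)
    \<comment> \<open>The induced map is obtained from the first isomorphism theorem for this homomorphism, which
      sends a cycle of the subcomplex to its class in the large complex.\<close>
    let ?h = "\<lambda>a. boundaries D d k #>\<^bsub>D k\<^esub> a"
    have rcos: "H #>\<^bsub>(D k)\<lparr>carrier := K\<rparr>\<^esub> a = H #>\<^bsub>D k\<^esub> a" for H K a
      by (simp add: r_coset_def)
    interpret normal "boundaries D d k" "(D k)\<lparr>carrier := cycles D d k\<rparr>"
      by (rule boundaries_normal_cycles[OF D])
    have h: "?h \<in> hom ((D k)\<lparr>carrier := cycles D d k\<rparr>) (homology D d k)"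
      using r_coset_hom_Mod unfolding homology_def rcos .
    have H: "group (homology D d k)"
      unfolding homology_def by (rule factorgroup_is_group)
    have cyc: "subgroup (cycles ?C d k) (?C k)" by (rule cycles_subgroup[OF C])
    have "group ((D k)\<lparr>carrier := cycles ?C d k\<rparr>)"
      using group.subgroup_imp_group[OF _ cyc] C by (simp add: chain_complex_def comm_group_def)
    moreover have "?h \<in> hom ((D k)\<lparr>carrier := cycles ?C d k\<rparr>) (homology D d k)"
      using h CD by (auto simp: hom_def)
    ultimately interpret h: group_hom "(D k)\<lparr>carrier := cycles ?C d k\<rparr>" "homology D d k" ?h
      using H by (simp add: group_hom_def group_hom_axioms_def)
    have bD: "subgroup (boundaries D d k) (D k)" by (rule boundaries_subgroup[OF D])
    have cD: "cycles D d k \<subseteq> carrier (D k)"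
      using subgroup.subset[OF cycles_subgroup[OF D]] .
    have sub: "boundaries ?C d k \<subseteq> boundaries D d k"
      using SD by (auto simp: boundaries_def)
    have ker: "kernel ((D k)\<lparr>carrier := cycles ?C d k\<rparr>) (homology D d k) ?h = boundaries ?C d k"
    proof (intro equalityI subsetI)
      fix a assume "a \<in> kernel ((D k)\<lparr>carrier := cycles ?C d k\<rparr>) (homology D d k) ?h"
      then have a: "a \<in> cycles D d k" "a \<in> S k" "?h a = boundaries D d k"
        by (auto simp: kernel_def CD homology_def FactGroup_def)
      then have "a \<in> boundaries D d k"
        using Dk.coset_join1[OF _ _ bD] cD by blast
      then obtain e where e: "e \<in> carrier (D (Suc k))" "a = d (Suc k) e"
        by (auto simp: boundaries_def)
      then obtain g m where gm: "g \<in> carrier (D (Suc (Suc k)))" "m \<in> S (Suc k)"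
          "e = d (Suc (Suc k)) g \<otimes>\<^bsub>D (Suc k)\<^esub> m"
        using absorb[of e "Suc k"] a by auto
      then have "a = d (Suc k) m" using d_absorb e by simp
      then show "a \<in> boundaries ?C d k" using gm by (auto simp: boundaries_def)
    next
      fix a assume a: "a \<in> boundaries ?C d k"
      then have "a \<in> boundaries D d k" "a \<in> cycles ?C d k"
        using sub boundaries_subset_cycles[OF C] by blast+
      then show "a \<in> kernel ((D k)\<lparr>carrier := cycles ?C d k\<rparr>) (homology D d k) ?h"
        using Dk.coset_join2[OF _ bD] cD by (auto simp: kernel_def CD homology_def FactGroup_def)
    qed
    have surj: "?h ` carrier ((D k)\<lparr>carrier := cycles ?C d k\<rparr>) = carrier (homology D d k)"
    proof
      show "?h ` carrier ((D k)\<lparr>carrier := cycles ?C d k\<rparr>) \<subseteq> carrier (homology D d k)"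
        using h.hom_closed by blast
      show "carrier (homology D d k) \<subseteq> ?h ` carrier ((D k)\<lparr>carrier := cycles ?C d k\<rparr>)"
      proof
        fix A assume "A \<in> carrier (homology D d k)"
        then obtain c where c: "c \<in> cycles D d k" "A = ?h c"
          by (auto simp: homology_def FactGroup_def RCOSETS_def rcos)
        have "k = 0 \<or> d k c \<in> S (k - 1)"
          using c(1) subgroup.one_closed[OF S] by (cases k) (auto simp: cycles_def kernel_def)
        then obtain g m where gm: "g \<in> carrier (D (Suc k))" "m \<in> S k" "c = d (Suc k) g \<otimes>\<^bsub>D k\<^esub> m"
          using absorb[of c k] c cD by blast
        have "m \<in> cycles D d k"
        proof (cases k)
          case 0 then show ?thesis using gm SD by (simp add: cycles_def)
        next
          case (Suc j)
          then show ?thesis using gm c(1) d_absorb[of g j m] SD by (auto simp: cycles_def kernel_def)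
        qed
        moreover have "c \<in> ?h m" using gm by (auto simp: r_coset_def boundaries_def)
        then have "?h m = ?h c"
          using Dk.repr_independence[OF _ _ bD] SD gm by blast
        ultimately show "A \<in> ?h ` carrier ((D k)\<lparr>carrier := cycles ?C d k\<rparr>)"
          using c gm by (auto simp: CD)
      qed
    qed
    have iso: "(\<lambda>A. the_elem (?h ` A)) \<in> iso (homology ?C d k) (homology D d k)"
      using h.FactGroup_iso_set[OF surj] unfolding ker by (simp add: homology_def)
    have eq: "homology_map D d (\<lambda>k c. c) k A = the_elem (?h ` A)"
      if A: "A \<in> carrier (homology ?C d k)" for A
    proof -
      obtain a where a: "a \<in> cycles ?C d k" "A = boundaries ?C d k #>\<^bsub>D k\<^esub> a"
        using A by (auto simp: homology_def FactGroup_def RCOSETS_def rcos)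
      have aD: "a \<in> carrier (D k)" using a CD SD by blast
      have "?h b = ?h a" if "b \<in> A" for b
        using that Dk.repr_independence[OF _ aD bD, of b] sub a by (auto simp: r_coset_def)
      moreover have "a \<in> A"
        using a subgroup.one_closed[OF boundaries_subgroup[OF C, of k]] aD
        by (force simp: r_coset_def)
      ultimately have "?h ` A = {?h a}" by blast
      then show ?thesis by (simp add: homology_map_def the_elem_def)
    qed
    have "homology_map D d (\<lambda>k c. c) k \<in> hom (homology ?C d k) (homology D d k)"
    proof (rule group.hom_restrict)
      show "group (homology ?C d k)"
        unfolding homology_def
        by (rule normal.factorgroup_is_group[OF boundaries_normal_cycles[OF C]])
      show "(\<lambda>A. the_elem (?h ` A)) \<in> hom (homology ?C d k) (homology D d k)"
        using iso by (simp add: iso_def)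
    qed (simp add: eq)
    moreover have "bij_betw (homology_map D d (\<lambda>k c. c) k)
        (carrier (homology ?C d k)) (carrier (homology D d k))"
      using iso bij_betw_cong[of "carrier (homology ?C d k)", OF eq] by (simp add: iso_def)
    ultimately show ?thesis by (simp add: iso_def)
  qed
  moreover have "chain_map ?C d D d (\<lambda>k c. c)"
    using SD by (auto simp: chain_map_def hom_def)
  ultimately show ?thesis
    using C D by (simp add: quasi_isomorphism_def)
qed

section \<open>Cancelling pairs of generators\<close>

text \<open>Here \<open>b u\<close> is the boundary of a generator \<open>u\<close>, and a pair in \<open>R\<close> consists of a source and
  the target that cancels it. The set \<open>T\<close> holds the generators in the degree of the sources that are
  not sources. The condition says that the matrix of \<open>b\<close> from targets to sources is triangular for
  \<open>rank\<close> with diagonal entries \<open>\<plusminus>1\<close>.\<close>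

definition cancelling_pairs ::
  "('b \<Rightarrow> nat) \<Rightarrow> ('b \<Rightarrow> 'b \<Rightarrow>\<^sub>0 int) \<Rightarrow> 'b set \<Rightarrow> ('b \<times> 'b) set \<Rightarrow> bool" where
  "cancelling_pairs rank b T R \<longleftrightarrow>
     (\<forall>(x, u) \<in> R. \<exists>\<epsilon>. \<bar>\<epsilon>\<bar> = 1 \<and>
        Poly_Mapping.keys (b u - frag_cmul \<epsilon> (frag_of x)) \<subseteq> T \<union> {y \<in> Domain R. rank y < rank x})"

lemma cancelling_pairsE:
  assumes "cancelling_pairs rank b T R" "(x, u) \<in> R"
  obtains \<epsilon> where "\<bar>\<epsilon>\<bar> = 1"
    "Poly_Mapping.keys (b u - frag_cmul \<epsilon> (frag_of x)) \<subseteq> T \<union> {y \<in> Domain R. rank y < rank x}"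
  using assms unfolding cancelling_pairs_def by blast

text \<open>Triangular elimination: \<open>b u\<close> expresses the source \<open>x\<close>, modulo boundaries and \<open>T\<close>, by sources
  of lower rank.\<close>

lemma cancelling_pairs_clear_sources:
  assumes R: "cancelling_pairs rank b T R"
    and e: "Poly_Mapping.keys e \<subseteq> T \<union> Domain R"
  shows "\<exists>g. Poly_Mapping.keys g \<subseteq> Range R \<and> Poly_Mapping.keys (e - frag_extend b g) \<subseteq> T"
proof -
  define P where
    "P e \<longleftrightarrow> (\<exists>g. Poly_Mapping.keys g \<subseteq> Range R \<and> Poly_Mapping.keys (e - frag_extend b g) \<subseteq> T)" for e
  have P0: "P 0" by (auto simp: P_def intro: exI[of _ 0])
  have Pdiff: "P (a - c)" if "P a" "P c" for a c
  proof -
    from that obtain g h where "Poly_Mapping.keys g \<subseteq> Range R" "Poly_Mapping.keys (a - frag_extend b g) \<subseteq> T"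
      "Poly_Mapping.keys h \<subseteq> Range R" "Poly_Mapping.keys (c - frag_extend b h) \<subseteq> T"
      by (auto simp: P_def)
    then have "Poly_Mapping.keys (g - h) \<subseteq> Range R"
      "Poly_Mapping.keys ((a - frag_extend b g) - (c - frag_extend b h)) \<subseteq> T"
      using keys_diff[of g h] keys_diff[of "a - frag_extend b g" "c - frag_extend b h"] by blast+
    moreover have "(a - frag_extend b g) - (c - frag_extend b h) = (a - c) - frag_extend b (g - h)"
      by (simp add: frag_extend_diff)
    ultimately show ?thesis
      unfolding P_def by (intro exI[of _ "g - h"]) simp
  qed
  have Pcmul: "P (frag_cmul n a)" if "P a" for n a
    using P0 Pdiff that by (rule frag_closure_minus_cmul)
  have span: "P e" if "Poly_Mapping.keys e \<subseteq> A" "\<And>x. x \<in> A \<Longrightarrow> P (frag_of x)" for e A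
    using that(1)
  proof (rule frag_induction)
    show "P 0" by (rule P0)
    show "P (frag_of x)" if "x \<in> A" for x by (rule \<open>\<And>x. x \<in> A \<Longrightarrow> P (frag_of x)\<close>[OF that])
    show "P (a - c)" if "P a" "P c" for a c by (rule Pdiff[OF that])
  qed
  have PT: "P (frag_of x)" if "x \<in> T" for x
    using that unfolding P_def by (intro exI[of _ 0]) simp
  have PD: "P (frag_of x)" if "x \<in> Domain R" for x
    using that
  proof (induction "rank x" arbitrary: x rule: less_induct)
    case less
    then obtain u where u: "(x, u) \<in> R" by blast
    obtain \<epsilon> where \<epsilon>: "\<bar>\<epsilon>\<bar> = 1" and
      k: "Poly_Mapping.keys (b u - frag_cmul \<epsilon> (frag_of x)) \<subseteq> T \<union> {y \<in> Domain R. rank y < rank x}"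
      using R u by (rule cancelling_pairsE)
    have "P (b u - frag_cmul \<epsilon> (frag_of x))"
      using k by (rule span) (use PT less in blast)
    moreover have "P (b u)"
      using u unfolding P_def by (intro exI[of _ "frag_of u"]) auto
    ultimately have "P (frag_cmul \<epsilon> (frag_of x))"
      using Pdiff[of "b u" "b u - frag_cmul \<epsilon> (frag_of x)"] by simp
    then have "P (frag_cmul (\<epsilon> * \<epsilon>) (frag_of x))"
      using Pcmul[of "frag_cmul \<epsilon> (frag_of x)" \<epsilon>] by simp
    moreover have "\<epsilon> * \<epsilon> = 1" using \<epsilon> by (auto simp: abs_if split: if_splits)
    ultimately show ?case by simp
  qed
  have "P e" using e by (rule span) (use PT PD in blast)
  then show ?thesis by (simp add: P_def)
qed

text \<open>Among the targets occurring in \<open>e\<close>, take one whose source \<open>x\<close> has maximal rank. By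
  triangularity no other target of \<open>e\<close> has \<open>x\<close> in its boundary, so \<open>x\<close> survives in the boundary
  of \<open>e\<close>.\<close>

lemma cancelling_pairs_no_targets:
  assumes R: "cancelling_pairs rank b T R"
    and T: "T \<inter> Domain R = {}" and sv: "single_valued R"
    and e: "Poly_Mapping.keys e \<subseteq> N \<union> Range R"
    and N: "\<And>n. n \<in> N \<Longrightarrow> Poly_Mapping.keys (b n) \<inter> Domain R = {}"
    and be: "Poly_Mapping.keys (frag_extend b e) \<inter> Domain R = {}"
  shows "Poly_Mapping.keys e \<subseteq> N"
proof (rule ccontr)
  assume "\<not> Poly_Mapping.keys e \<subseteq> N"
  define K where "K = Poly_Mapping.keys e - N"
  have K: "finite K" "K \<noteq> {}" "K \<subseteq> Range R"
    using \<open>\<not> _\<close> e by (auto simp: K_def)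
  then have "\<forall>u \<in> K. \<exists>x. (x, u) \<in> R" by blast
  then obtain s where s: "\<And>u. u \<in> K \<Longrightarrow> (s u, u) \<in> R" by metis
  obtain u where u: "u \<in> K" "\<And>v. v \<in> K \<Longrightarrow> rank (s v) \<le> rank (s u)"
  proof -
    have "Max ((rank \<circ> s) ` K) \<in> (rank \<circ> s) ` K"
      using K(1,2) by (intro Max_in) simp_all
    then obtain u where "u \<in> K" "Max ((rank \<circ> s) ` K) = rank (s u)" by auto
    then show thesis using that[of u] Max_ge[of "(rank \<circ> s) ` K"] K(1) by simp
  qed
  have su: "s u \<in> Domain R" "s u \<notin> T" using s[OF u(1)] T by blast+
  have other: "Poly_Mapping.lookup (b v) (s u) = 0" if v: "v \<in> Poly_Mapping.keys e" "v \<noteq> u" for v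
  proof (cases "v \<in> N")
    case True
    then show ?thesis using N[of v] su by (auto simp: in_keys_iff)
  next
    case False
    then have vK: "v \<in> K" using v by (simp add: K_def)
    have ne: "s u \<noteq> s v"
      using single_valuedD[OF sv s[OF u(1)], of v] s[OF vK] v by auto
    obtain \<epsilon> where
      "Poly_Mapping.keys (b v - frag_cmul \<epsilon> (frag_of (s v)))
         \<subseteq> T \<union> {y \<in> Domain R. rank y < rank (s v)}"
      using R s[OF vK] by (rule cancelling_pairsE)
    then have "s u \<notin> Poly_Mapping.keys (b v - frag_cmul \<epsilon> (frag_of (s v)))"
      using su u(2)[OF vK] by fastforce
    then show ?thesis using ne by (simp add: in_keys_iff lookup_minus)
  qed
  obtain \<epsilon> where \<epsilon>: "\<bar>\<epsilon>\<bar> = 1" and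
    "Poly_Mapping.keys (b u - frag_cmul \<epsilon> (frag_of (s u)))
       \<subseteq> T \<union> {y \<in> Domain R. rank y < rank (s u)}"
    using R s[OF u(1)] by (rule cancelling_pairsE)
  then have "s u \<notin> Poly_Mapping.keys (b u - frag_cmul \<epsilon> (frag_of (s u)))"
    using su by fastforce
  then have "Poly_Mapping.lookup (b u) (s u) = \<epsilon>" by (simp add: in_keys_iff lookup_minus)
  moreover have ue: "u \<in> Poly_Mapping.keys e" using u by (simp add: K_def)
  moreover have "Poly_Mapping.lookup (frag_extend b e) (s u)
      = (\<Sum>v \<in> Poly_Mapping.keys e. Poly_Mapping.lookup e v * Poly_Mapping.lookup (b v) (s u))"
    by (simp add: frag_extend_def lookup_sum)
  moreover have "\<dots> = Poly_Mapping.lookup e u * Poly_Mapping.lookup (b u) (s u)"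
    by (subst sum.remove[OF finite_keys ue]) (simp_all add: other)
  ultimately have "Poly_Mapping.lookup (frag_extend b e) (s u) = Poly_Mapping.lookup e u * \<epsilon>"
    by simp
  moreover have "Poly_Mapping.lookup e u \<noteq> 0" "\<epsilon> \<noteq> 0"
    using ue \<epsilon> by (auto simp: in_keys_iff)
  ultimately have "s u \<in> Poly_Mapping.keys (frag_extend b e)"
    by (simp add: in_keys_iff)
  then show False using be su by blast
qed

section \<open>Inserting gates\<close>

lemma keys_face_subset:
  assumes "xs \<in> k_paths A (Suc k)" "i < Suc (Suc k)"
  shows "Poly_Mapping.keys (face I i xs) \<subseteq> {delete_nth i xs} \<inter> k_paths A k"
  using assms set_delete_nth[of i xs] by (auto simp: face_def k_paths_iff)

lemma delete_nth_append_Cons: "delete_nth (length l) (l @ w # r) = l @ r"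
  by (simp add: delete_nth_def)

locale gates =
  fixes X Y Z :: "'a set" and I :: "'a \<Rightarrow> 'a \<Rightarrow> 'a set" and \<pi> :: "'a \<Rightarrow> 'a"
  assumes union: "X = Y \<union> Z"
    and gate_mem: "z \<in> Z \<Longrightarrow> \<pi> z \<in> Y \<inter> Z"
    and gate_after: "\<lbrakk>z \<in> Z; y \<in> Y\<rbrakk> \<Longrightarrow> \<pi> z \<in> I z y"
    and gate_before: "\<lbrakk>y \<in> Y; z \<in> Z\<rbrakk> \<Longrightarrow> \<pi> z \<in> I y z"
begin

text \<open>For \<open>slot p s g\<close>, the first crossing of \<open>p @ s\<close> is cut so that the gate \<open>g\<close> of its point in
  \<open>Z - Y\<close> goes between \<open>p\<close> and \<open>s\<close>, next to that point. When the path enters \<open>Z - Y\<close> from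
  \<open>Y - Z\<close>, this is just before the first point outside \<open>Y\<close>. When it leaves \<open>Z - Y\<close>, it is just
  after the last point outside \<open>Y\<close> that precedes the first point outside \<open>Z\<close>. Both conditions
  only restrict which side the points lie on, so they persist when points of \<open>Y \<inter> Z\<close> are inserted
  or deleted away from \<open>z\<close>.\<close>

inductive slot :: "'a list \<Rightarrow> 'a list \<Rightarrow> 'a \<Rightarrow> bool" where
  enter: "\<lbrakk>set p \<subseteq> Y; \<not> set p \<subseteq> Z; z \<in> Z - Y\<rbrakk> \<Longrightarrow> slot p (z # s) (\<pi> z)"
| leave: "\<lbrakk>set p \<subseteq> Z; z \<in> Z - Y; set ws \<subseteq> Y \<inter> Z; y \<in> Y - Z\<rbrakk> \<Longrightarrow> slot (p @ [z]) (ws @ y # s) (\<pi> z)"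

text \<open>One cut of a list cannot lie strictly before another: the segment \<open>us\<close> between them would
  belong to the initial part of the second cut, which stays on one side, although the first cut
  already marks a change of side.\<close>

lemma slot_unique_aux:
  assumes "slot p s g" "slot (p @ us) s' g'" "s = us @ s'"
  shows "us = []"
proof (rule ccontr)
  assume us: "us \<noteq> []"
  from assms(1) show False
  proof (cases rule: slot.cases)
    case (enter z t)
    have "hd us = z" using us assms(3) enter by (cases us) auto
    moreover from assms(2) have "set us \<subseteq> Y"
    proof (cases rule: slot.cases)
      case (leave q z')
      then have "set (p @ us) \<subseteq> Z" by simp
      then show ?thesis using enter by simp
    qed simp
    ultimately show False using us enter hd_in_set[of us] by blast
  next
    case (leave q z ws y t)
    from assms(2) have us': "last us \<in> Z - Y" "set us \<subseteq> Z"
    proof (atomize(full), cases rule: slot.cases)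
      case (enter z')
      then show "last us \<in> Z - Y \<and> set us \<subseteq> Z" using leave by auto
    next
      case (leave q' z')
      have "last (p @ us) = z'" "set (p @ us) \<subseteq> Z" using leave by auto
      then have "last us = z'" "set us \<subseteq> Z" using us by simp_all
      then show "last us \<in> Z - Y \<and> set us \<subseteq> Z" using leave by simp
    qed
    have "ws @ y # t = us @ s'" using assms(3) leave by simp
    then obtain v where "ws = us @ v \<or> (us = ws @ v \<and> v @ s' = y # t)"
      by (metis append_eq_append_conv2)
    then have "set us \<subseteq> Y \<or> y \<in> set us"
      using leave by (cases v) auto
    then show False using us us' leave last_in_set[OF us] by blast
  qed
qed

lemma slot_gate: "slot p s g \<Longrightarrow> g \<in> Y \<inter> Z"
  by (cases rule: slot.cases) (use gate_mem in auto)

lemma slot_unique: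
  assumes "slot p s g" "slot p' s' g'" "p @ s = p' @ s'"
  shows "p = p' \<and> s = s' \<and> g = g'"
proof -
  obtain us where "p' = p @ us \<and> s = us @ s' \<or> p = p' @ us \<and> s' = us @ s"
    using assms(3) by (metis append_eq_append_conv2)
  then have eq: "p = p'" "s = s'"
    using slot_unique_aux[of p s g us s' g'] slot_unique_aux[of p' s' g' us s g] assms by auto
  have "g = g'"
    using assms(1)
  proof (cases rule: slot.cases)
    case (enter z t)
    from assms(2) show ?thesis by (cases rule: slot.cases) (use enter eq in auto)
  next
    case (leave q z ws y t)
    from assms(2) show ?thesis by (cases rule: slot.cases) (use leave eq in auto)
  qed
  with eq show ?thesis by simp
qed

text \<open>Exactly one of the two points at the cut lies in \<open>Y\<close>. Hence removing the gate from a path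
  creates no repetition.\<close>

lemma slot_last_neq_hd: "slot p s g \<Longrightarrow> p \<noteq> [] \<and> s \<noteq> [] \<and> last p \<noteq> hd s"
proof (induction rule: slot.induct)
  case (enter p z s)
  then have "p \<noteq> []" by auto
  then have "last p \<in> Y" using enter last_in_set[of p] by blast
  then show ?case using enter \<open>p \<noteq> []\<close> by auto
next
  case (leave p z ws y s)
  then show ?case by (cases ws) auto
qed

text \<open>The point facing \<open>z\<close> across the cut lies in \<open>Y\<close>. On entering, the gate property is needed
  from that point to \<open>z\<close>; on leaving, from \<open>z\<close> to that point.\<close>

lemma slot_between: "slot p s g \<Longrightarrow> g \<in> I (last p) (hd s)"
proof (induction rule: slot.induct)
  case (enter p z s)
  then have "p \<noteq> []" by auto
  then have "last p \<in> Y" using enter last_in_set[of p] by blast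
  then show ?case using enter gate_before by simp
next
  case (leave p z ws y s)
  then have "hd (ws @ y # s) \<in> Y" by (cases ws) auto
  then show ?case using leave gate_after by simp
qed

text \<open>The first point outside \<open>Z\<close> decides: if a point outside \<open>Y\<close> precedes it, the first crossing
  leaves \<open>Z - Y\<close>, and otherwise it enters.\<close>

lemma slot_exists:
  assumes "set xs \<subseteq> X" "\<not> set xs \<subseteq> Y" "\<not> set xs \<subseteq> Z"
  shows "\<exists>p s g. xs = p @ s \<and> slot p s g"
proof -
  obtain p y t where y: "xs = p @ y # t" "y \<notin> Z" "set p \<subseteq> Z"
    using split_list_first_prop[of xs "\<lambda>x. x \<notin> Z"] assms(3) by blast
  then have yY: "y \<in> Y - Z" using assms(1) union by auto
  show ?thesis
  proof (cases "set p \<subseteq> Y")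
    case True
    then have "\<exists>x \<in> set t. x \<notin> Y" using assms(2) y yY by auto
    then obtain q z r where z: "t = q @ z # r" "z \<notin> Y" "set q \<subseteq> Y"
      using split_list_first_prop[of t "\<lambda>x. x \<notin> Y"] by blast
    have "slot (p @ y # q) (z # r) (\<pi> z)"
      using z y yY True assms(1) union by (intro enter) auto
    moreover have "xs = (p @ y # q) @ (z # r)" using y z by simp
    ultimately show ?thesis by blast
  next
    case False
    then obtain q z ws where z: "p = q @ z # ws" "z \<notin> Y" "set ws \<subseteq> Y"
      using split_list_last_prop[of p "\<lambda>x. x \<notin> Y"] by blast
    have "slot (q @ [z]) (ws @ y # t) (\<pi> z)"
      using z y yY by (intro leave) auto
    moreover have "xs = (q @ [z]) @ (ws @ y # t)" using y z by simp
    ultimately show ?thesis by blast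
  qed
qed

text \<open>A gate already present stands on the side of the cut away from \<open>z\<close>: at the end of \<open>p\<close> when
  the path enters, at the start of \<open>s\<close> when it leaves. The next three lemmas pass between the cut of
  a path that contains the gate and the cut of the path without it.\<close>

lemma slot_drop_gate_before: "slot (p @ [g]) s g \<Longrightarrow> slot p s g"
proof -
  assume s: "slot (p @ [g]) s g"
  then have g: "g \<in> Y \<inter> Z" by (rule slot_gate)
  from s show ?thesis
  proof (cases rule: slot.cases)
    case (enter z t)
    then show ?thesis using slot.enter[of p z t] g by auto
  next
    case (leave q z) then show ?thesis using g by auto
  qed
qed

lemma slot_drop_gate_after: "slot p (g # s) g \<Longrightarrow> slot p s g"
proof -
  assume s: "slot p (g # s) g"
  then have g: "g \<in> Y \<inter> Z" by (rule slot_gate)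
  from s show ?thesis
  proof (cases rule: slot.cases)
    case enter
    then show ?thesis using g by auto
  next
    case (leave q z ws y t)
    then obtain ws' where "ws = g # ws'" using g by (cases ws) auto
    then show ?thesis using leave slot.leave[of q z ws' y t] by auto
  qed
qed

lemma slot_add_gate:
  assumes "slot p s g"
  shows "slot (p @ [g]) s g \<or> slot p (g # s) g"
  using assms
proof (cases rule: slot.cases)
  case (enter z t)
  then show ?thesis using slot.enter[of "p @ [g]" z t] slot_gate[OF assms] by auto
next
  case (leave q z ws y t)
  then show ?thesis using slot.leave[of q z "g # ws" y t] slot_gate[OF assms] by auto
qed

lemma slot_delete_before:
  assumes "slot (l @ w # r) s g" "w \<in> Y \<inter> Z"
  shows "slot (l @ r) s g"
  using assms(1)
proof (cases rule: slot.cases)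
  case (enter z t)
  then show ?thesis using slot.enter[of "l @ r" z t] assms(2) by auto
next
  case (leave q z ws y t)
  obtain r' where "r = r' @ [z]"
    using leave assms(2) by (cases r rule: rev_cases) auto
  then show ?thesis using leave slot.leave[of "l @ r'" z ws y t] by auto
qed

lemma slot_delete_after:
  assumes "slot p (l @ w # r) g" "w \<in> Y \<inter> Z"
  shows "slot p (l @ r) g"
  using assms(1)
proof (cases rule: slot.cases)
  case (enter z t)
  then obtain l' where "l = z # l'"
    using assms(2) by (cases l) auto
  then show ?thesis using enter slot.enter[of p z "l' @ r"] by auto
next
  case (leave q z ws y t)
  have "y \<noteq> w" using leave assms(2) by auto
  have eq: "l @ w # r = ws @ y # t" using leave by simp
  then obtain v where "l = ws @ v \<and> v @ w # r = y # t \<or> l @ v = ws \<and> w # r = v @ y # t"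
    by (metis append_eq_append_conv2)
  then show ?thesis
  proof (elim disjE conjE)
    assume v: "l = ws @ v" "v @ w # r = y # t"
    then obtain v' where "v = y # v'" using \<open>y \<noteq> w\<close> by (cases v) auto
    then show ?thesis using v leave slot.leave[of q z ws y "v' @ r"] by simp
  next
    assume v: "l @ v = ws" "w # r = v @ y # t"
    then obtain v' where v': "v = w # v'" using \<open>y \<noteq> w\<close> by (cases v) auto
    then have "set (l @ v') \<subseteq> Y \<inter> Z" "r = v' @ y # t" using v leave by auto
    then show ?thesis using leave slot.leave[of q z "l @ v'" y t] by simp
  qed
qed

text \<open>The index is the degree of the targets; the sources have degree one less.\<close>

definition gate_pairs :: "nat \<Rightarrow> ('a list \<times> 'a list) set" where
  "gate_pairs k = {(p @ s, p @ g # s) | p s g. slot p s g \<and> p @ g # s \<in> k_paths X k}"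

definition unmixed :: "nat \<Rightarrow> 'a list set" where
  "unmixed k = k_paths Y k \<union> k_paths Z k"

definition rank :: "'a list \<Rightarrow> nat" where
  "rank xs = length (filter (\<lambda>x. x \<notin> Y \<inter> Z) xs)"

lemma gate_pairsI:
  "slot p s g \<Longrightarrow> p @ g # s \<in> k_paths X k \<Longrightarrow> (p @ s, p @ g # s) \<in> gate_pairs k"
  by (auto simp: gate_pairs_def)

lemma gate_pairsE:
  assumes "(x, u) \<in> gate_pairs k"
  obtains p s g where "slot p s g" "x = p @ s" "u = p @ g # s" "u \<in> k_paths X k"
  using assms by (auto simp: gate_pairs_def)

lemma gate_pairs_source:
  assumes "slot p s g" "p @ g # s \<in> k_paths X (Suc k)"
  shows "p @ s \<in> k_paths X k"
  using assms slot_last_neq_hd[OF assms(1)]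
  by (auto simp: k_paths_iff distinct_adj_append_iff distinct_adj_Cons)

lemma Range_gate_pairs_0: "Range (gate_pairs 0) = {}"
  using slot_last_neq_hd by (fastforce simp: gate_pairs_def k_paths_iff)

lemma Range_gate_pairs: "Range (gate_pairs k) \<subseteq> k_paths X k"
  by (auto simp: gate_pairs_def)

lemma slot_mixed:
  assumes "slot p s g"
  shows "\<not> set (p @ s) \<subseteq> Y \<and> \<not> set (p @ s) \<subseteq> Z"
  using assms by (cases rule: slot.cases) auto

text \<open>A mixed path with its gate next to the cut is a target. Without it, the gate can be inserted
  without creating a repetition, and the path is a source.\<close>

lemma k_paths_trichotomy:
  assumes x: "x \<in> k_paths X k"
  shows "x \<in> unmixed k \<union> Range (gate_pairs k) \<union> Domain (gate_pairs (Suc k))"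
proof (cases "x \<in> unmixed k")
  case False
  then have "\<not> set x \<subseteq> Y" "\<not> set x \<subseteq> Z" "set x \<subseteq> X"
    using x by (auto simp: unmixed_def k_paths_iff)
  then obtain p s g where ps: "x = p @ s" "slot p s g" using slot_exists by blast
  consider "last p = g" | "hd s = g" | "last p \<noteq> g" "hd s \<noteq> g" by blast
  then show ?thesis
  proof cases
    case 1
    then obtain q where q: "p = q @ [g]" using slot_last_neq_hd[OF ps(2)] by (metis append_butlast_last_id)
    then have "(q @ s, q @ g # s) \<in> gate_pairs k"
      using slot_drop_gate_before[of q g s] ps x by (intro gate_pairsI) auto
    then show ?thesis using ps q by auto
  next
    case 2
    then obtain t where t: "s = g # t" using slot_last_neq_hd[OF ps(2)] by (cases s) auto
    then have "(p @ t, p @ g # t) \<in> gate_pairs k"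
      using slot_drop_gate_after[of p g t] ps x by (intro gate_pairsI) auto
    then show ?thesis using ps t by auto
  next
    case 3
    have "g \<in> X" using slot_gate[OF ps(2)] union by auto
    then have "p @ g # s \<in> k_paths X (Suc k)"
      using x ps 3 slot_last_neq_hd[OF ps(2)]
      by (auto simp: k_paths_iff distinct_adj_append_iff distinct_adj_Cons)
    then have "(p @ s, p @ g # s) \<in> gate_pairs (Suc k)"
      using ps by (intro gate_pairsI)
    then show ?thesis using ps by auto
  qed
qed blast

text \<open>If a source contained the gate of its own crossing, uniqueness of the cut would place it next
  to the cut, and inserting it once more would give two equal consecutive points.\<close>

lemma gate_pairs_disjoint:
  "(unmixed k \<union> Range (gate_pairs k)) \<inter> Domain (gate_pairs (Suc k)) = {}"
proof -
  have "x \<notin> unmixed k \<union> Range (gate_pairs k)" if "(x, u) \<in> gate_pairs (Suc k)" for x u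
  proof -
    from that obtain p s g
      where 1: "slot p s g" "x = p @ s" "u = p @ g # s" "u \<in> k_paths X (Suc k)"
      by (rule gate_pairsE)
    have "distinct_adj (p @ g # s)" using 1(3,4) by (simp add: k_paths_iff)
    then have ne: "last p \<noteq> g" "hd s \<noteq> g"
      using slot_last_neq_hd[OF 1(1)] by (auto simp: distinct_adj_append_iff distinct_adj_Cons)
    have "x \<notin> unmixed k"
      using slot_mixed[OF 1(1)] 1(2) by (auto simp: unmixed_def k_paths_iff)
    moreover have False if y: "(y, x) \<in> gate_pairs k" for y
    proof -
      from y obtain q t h where 2: "slot q t h" "x = q @ h # t" by (rule gate_pairsE)
      from slot_add_gate[OF 2(1)] show False
      proof
        assume "slot (q @ [h]) t h"
        then have "p = q @ [h]" "g = h"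
          using slot_unique[OF 1(1), of "q @ [h]" t h] 1(2) 2(2) by simp_all
        then show False using ne by simp
      next
        assume "slot q (h # t) h"
        then have "s = h # t" "g = h"
          using slot_unique[OF 1(1), of q "h # t" h] 1(2) 2(2) by simp_all
        then show False using ne by simp
      qed
    qed
    ultimately show ?thesis by blast
  qed
  then show ?thesis by blast
qed

lemma single_valued_gate_pairs: "single_valued (gate_pairs k)"
proof (rule single_valuedI)
  fix x u v assume "(x, u) \<in> gate_pairs k" "(x, v) \<in> gate_pairs k"
  then obtain p s g p' s' g' where "slot p s g" "x = p @ s" "u = p @ g # s"
    "slot p' s' g'" "x = p' @ s'" "v = p' @ g' # s'"
    by (meson gate_pairsE)
  then show "u = v" using slot_unique[of p s g p' s' g'] by simp
qed

lemma rank_gate: "slot p s g \<Longrightarrow> rank (p @ g # s) = rank (p @ s)"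
  using slot_gate by (auto simp: rank_def)

text \<open>This is the triangularity of the pairing: deleting a point of \<open>Y \<inter> Z\<close> other than the gate
  leaves the gate in its place at the first crossing, and deleting any other point lowers the
  rank.\<close>

lemma face_of_target:
  assumes ps: "slot p s g" and u: "p @ g # s \<in> k_paths X (Suc k)"
    and i: "i < Suc (Suc k)" "i \<noteq> length p"
    and y: "delete_nth i (p @ g # s) \<in> k_paths X k"
  shows "delete_nth i (p @ g # s) \<in> unmixed k \<union> Range (gate_pairs k)
           \<union> {y \<in> Domain (gate_pairs (Suc k)). rank y < rank (p @ s)}"
proof -
  have lower: ?thesis if "w \<notin> Y \<inter> Z" "delete_nth i (p @ g # s) = l @ r" "p @ g # s = l @ w # r" for l w r
  proof -
    have "rank (l @ r) < rank (p @ g # s)"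
      unfolding that(3) using that(1) by (simp add: rank_def)
    then show ?thesis
      using k_paths_trichotomy[OF y] rank_gate[OF ps] that(2) by auto
  qed
  show ?thesis
  proof (cases "i < length p")
    case True
    then obtain l w v where p: "p = l @ w # v" "length l = i"
      using id_take_nth_drop[OF True] by (metis length_take less_imp_le min.absorb2)
    then have del: "delete_nth i (p @ g # s) = l @ v @ g # s"
      using delete_nth_append_Cons[of l w "v @ g # s"] by simp
    show ?thesis
    proof (cases "w \<in> Y \<inter> Z")
      case True
      then have "slot (l @ v) s g" using slot_delete_before ps p by blast
      then have "((l @ v) @ s, (l @ v) @ g # s) \<in> gate_pairs k"
        using y unfolding del by (intro gate_pairsI) simp_all
      then show ?thesis unfolding del by auto
    qed (use lower[of w l "v @ g # s"] del p in simp)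
  next
    case False
    \<comment> \<open>The position of the deleted point within \<open>s\<close>, after the entries of \<open>p\<close> and the gate.\<close>
    define j where "j = i - Suc (length p)"
    have j: "j < length s" "i = length (p @ g # take j s)"
      using False i u by (auto simp: j_def k_paths_iff)
    then obtain l w v where s: "s = l @ w # v" "i = length (p @ g # l)"
      using id_take_nth_drop[OF j(1)] by blast
    then have del: "delete_nth i (p @ g # s) = p @ g # l @ v"
      using delete_nth_append_Cons[of "p @ g # l" w v] by simp
    show ?thesis
    proof (cases "w \<in> Y \<inter> Z")
      case True
      then have "slot p (l @ v) g" using slot_delete_after ps s by blast
      then have "(p @ l @ v, p @ g # l @ v) \<in> gate_pairs k"
        using y unfolding del by (intro gate_pairsI) simp_all
      then show ?thesis unfolding del by auto
    qed (use lower[of w "p @ g # l" v] del s in simp)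
  qed
qed

definition path_boundary :: "nat \<Rightarrow> 'a list \<Rightarrow> ('a list \<Rightarrow>\<^sub>0 int)" where
  "path_boundary k xs = (\<Sum>i = 1..<k. frag_cmul ((-1) ^ i) (face I i xs))"

lemma boundary_eq_frag_extend: "boundary I k = frag_extend (path_boundary k)"
  by (simp add: boundary_def path_boundary_def[abs_def])

lemma keys_signed_faces_subset:
  assumes "\<And>i. i \<in> J \<Longrightarrow> Poly_Mapping.keys (face I i xs) \<subseteq> B"
  shows "Poly_Mapping.keys (\<Sum>i\<in>J. frag_cmul ((-1) ^ i) (face I i xs)) \<subseteq> B"
proof -
  have "Poly_Mapping.keys (frag_cmul ((-1) ^ i) (face I i xs)) \<subseteq> B" if "i \<in> J" for i
    using keys_cmul assms[OF that] by (rule order_trans)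
  then show ?thesis
    using keys_sum[of "\<lambda>i. frag_cmul ((-1) ^ i) (face I i xs)" J] by blast
qed

lemma cancelling_gate_pairs:
  "cancelling_pairs rank (path_boundary (Suc k)) (unmixed k \<union> Range (gate_pairs k)) (gate_pairs (Suc k))"
  unfolding cancelling_pairs_def
proof (clarify)
  fix x u assume "(x, u) \<in> gate_pairs (Suc k)"
  then obtain p s g where ps: "slot p s g" "x = p @ s" "u = p @ g # s" and u: "u \<in> k_paths X (Suc k)"
    by (rule gate_pairsE)
  let ?n = "length p"
  have n: "?n \<in> {1..<Suc k}" and ne: "p \<noteq> []" "s \<noteq> []"
    using u ps slot_last_neq_hd[OF ps(1)] by (auto simp: k_paths_iff Suc_le_eq simp flip: length_greater_0_conv)
  have del: "delete_nth ?n u = x" using ps delete_nth_append_Cons by metis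
  have "face I ?n u = frag_of x"
  proof -
    have "u ! (?n - 1) = last p" "u ! ?n = g" "u ! (?n + 1) = hd s"
      using ne ps by (auto simp: nth_append last_conv_nth hd_conv_nth)
    moreover have "distinct_adj x"
      using gate_pairs_source[of p s g k] ps u by (simp add: k_paths_iff)
    ultimately show ?thesis
      using slot_between[OF ps(1)] by (simp add: face_def del)
  qed
  then have "path_boundary (Suc k) u - frag_cmul ((-1) ^ ?n) (frag_of x)
      = (\<Sum>i \<in> {1..<Suc k} - {?n}. frag_cmul ((-1) ^ i) (face I i u))"
    using sum.remove[OF _ n, of "\<lambda>i. frag_cmul ((-1) ^ i) (face I i u)"]
    by (simp add: path_boundary_def del: sum.op_ivl_Suc)
  also have "Poly_Mapping.keys \<dots> \<subseteq> unmixed k \<union> Range (gate_pairs k)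
      \<union> {y \<in> Domain (gate_pairs (Suc k)). rank y < rank x}"
  proof (rule keys_signed_faces_subset)
    fix i assume i: "i \<in> {1..<Suc k} - {?n}"
    have "Poly_Mapping.keys (face I i u) \<subseteq> {delete_nth i u} \<inter> k_paths X k"
      using i by (intro keys_face_subset[OF u]) simp
    moreover have "delete_nth i u \<in> unmixed k \<union> Range (gate_pairs k)
      \<union> {y \<in> Domain (gate_pairs (Suc k)). rank y < rank x}" if "delete_nth i u \<in> k_paths X k"
      unfolding ps(2,3)
    proof (rule face_of_target[OF ps(1)])
      show "p @ g # s \<in> k_paths X (Suc k)" "delete_nth i (p @ g # s) \<in> k_paths X k"
        using u that ps by simp_all
    qed (use i in auto)
    ultimately show "Poly_Mapping.keys (face I i u) \<subseteq> unmixed k \<union> Range (gate_pairs k)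
      \<union> {y \<in> Domain (gate_pairs (Suc k)). rank y < rank x}"
      by blast
  qed
  finally show "\<exists>\<epsilon>. \<bar>\<epsilon>\<bar> = 1 \<and>
      Poly_Mapping.keys (path_boundary (Suc k) u - frag_cmul \<epsilon> (frag_of x))
        \<subseteq> unmixed k \<union> Range (gate_pairs k) \<union> {y \<in> Domain (gate_pairs (Suc k)). rank y < rank x}"
    by (intro exI[of _ "(-1) ^ ?n"]) (auto simp: power_abs)
qed

lemma keys_path_boundary_unmixed:
  assumes "xs \<in> unmixed (Suc k)"
  shows "Poly_Mapping.keys (path_boundary (Suc k) xs) \<subseteq> unmixed k"
  unfolding path_boundary_def
proof (rule keys_signed_faces_subset)
  fix i assume "i \<in> {1..<Suc k}"
  then show "Poly_Mapping.keys (face I i xs) \<subseteq> unmixed k"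
    using assms keys_face_subset[of xs Y k i I] keys_face_subset[of xs Z k i I]
    by (auto simp: unmixed_def)
qed

lemma keys_boundary_unmixed:
  assumes "Poly_Mapping.keys c \<subseteq> unmixed (Suc k)"
  shows "Poly_Mapping.keys (boundary I (Suc k) c) \<subseteq> unmixed k"
  using assms keys_frag_extend[of "path_boundary (Suc k)" c] keys_path_boundary_unmixed
  unfolding boundary_eq_frag_extend by blast

text \<open>The sources are cleared first. As the square of the boundary is zero, this does not change the
  boundary of the chain, so the second step applies to the corrected chain, with the pairing one
  degree lower.\<close>

lemma unmixed_modulo_boundary:
  assumes complex: "chain_complex (MC X) (boundary I)"
    and e: "Poly_Mapping.keys e \<subseteq> k_paths X k"
    and de: "k = 0 \<or> Poly_Mapping.keys (boundary I k e) \<subseteq> unmixed (k - 1)"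
  shows "\<exists>g. Poly_Mapping.keys g \<subseteq> k_paths X (Suc k)
           \<and> Poly_Mapping.keys (e - boundary I (Suc k) g) \<subseteq> unmixed k"
proof -
  have "Poly_Mapping.keys e \<subseteq> (unmixed k \<union> Range (gate_pairs k)) \<union> Domain (gate_pairs (Suc k))"
    using e k_paths_trichotomy by blast
  then obtain g where g0: "Poly_Mapping.keys g \<subseteq> Range (gate_pairs (Suc k))" and
    e': "Poly_Mapping.keys (e - boundary I (Suc k) g) \<subseteq> unmixed k \<union> Range (gate_pairs k)"
    unfolding boundary_eq_frag_extend
    by (metis cancelling_pairs_clear_sources[OF cancelling_gate_pairs])
  have g: "Poly_Mapping.keys g \<subseteq> k_paths X (Suc k)"
    using g0 Range_gate_pairs by (rule order_trans)
  have "Poly_Mapping.keys (e - boundary I (Suc k) g) \<subseteq> unmixed k"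
  proof (cases k)
    case 0
    then show ?thesis using e' Range_gate_pairs_0 by simp
  next
    case (Suc j)
    have "boundary I (Suc j) (boundary I (Suc (Suc j)) g) = 0"
      using complex g Suc by (auto simp: chain_complex_def MC_def)
    then have "boundary I (Suc j) (e - boundary I (Suc k) g) = boundary I (Suc j) e"
      by (simp add: boundary_eq_frag_extend frag_extend_diff Suc)
    then have "Poly_Mapping.keys (frag_extend (path_boundary (Suc j)) (e - boundary I (Suc k) g)) \<subseteq> unmixed j"
      using de by (simp add: Suc boundary_eq_frag_extend)
    then have be: "Poly_Mapping.keys (frag_extend (path_boundary (Suc j)) (e - boundary I (Suc k) g))
        \<inter> Domain (gate_pairs (Suc j)) = {}"
      using gate_pairs_disjoint[of j] by blast
    have N: "Poly_Mapping.keys (path_boundary (Suc j) n) \<inter> Domain (gate_pairs (Suc j)) = {}"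
      if "n \<in> unmixed (Suc j)" for n
      using keys_path_boundary_unmixed[OF that] gate_pairs_disjoint[of j] by blast
    have "Poly_Mapping.keys (e - boundary I (Suc k) g)
        \<subseteq> unmixed (Suc j) \<union> Range (gate_pairs (Suc j))"
      using e' Suc by simp
    from cancelling_pairs_no_targets[OF cancelling_gate_pairs gate_pairs_disjoint
        single_valued_gate_pairs this N be]
    have "Poly_Mapping.keys (e - boundary I (Suc k) g) \<subseteq> unmixed (Suc j)" by blast
    then show ?thesis by (simp add: Suc)
  qed
  with g show ?thesis by blast
qed

end

theorem proposition6p21:
  fixes X Y Z :: "'a set" and I :: "'a \<Rightarrow> 'a \<Rightarrow> 'a set" and \<pi> :: "'a \<Rightarrow> 'a"
  assumes space: "betweenness_space X I"
    and complex: "chain_complex (MC X) (boundary I)"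
    and gated: "gated_decomposition X I Y Z \<pi>"
    and gate_reverse: "\<And>y z. y \<in> Y \<Longrightarrow> z \<in> Z \<Longrightarrow> \<pi> z \<in> I y z"
  shows "quasi_isomorphism (MC_pair Y Z) (boundary I) (MC X) (boundary I) (\<lambda>k c. c)"
proof -
  interpret gates X Y Z I \<pi>
    using gated gate_reverse by unfold_locales (auto simp: gated_decomposition_def)
  define S :: "nat \<Rightarrow> ('a list \<Rightarrow>\<^sub>0 int) set" where "S k = {c. Poly_Mapping.keys c \<subseteq> unmixed k}" for k
  have unmixed: "unmixed k \<subseteq> k_paths X k" for k
    using union by (auto simp: unmixed_def k_paths_iff)
  have pair: "MC_pair Y Z = (\<lambda>k. (MC X k)\<lparr>carrier := S k\<rparr>)"
    by (auto simp: MC_pair_def MC_def S_def unmixed_def free_Abelian_group_def)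
  have grp: "group (MC X k)" "group (MC_pair Y Z k)" for k
    by (simp_all add: MC_def MC_pair_def)
  show ?thesis
    unfolding pair
  proof (rule inclusion_quasi_isomorphism[OF complex])
    fix k
    have "group ((MC X k)\<lparr>carrier := S k\<rparr>)" using grp(2)[of k] by (simp add: pair)
    moreover have "S k \<subseteq> carrier (MC X k)" using unmixed[of k] by (auto simp: S_def MC_def)
    ultimately show "subgroup (S k) (MC X k)"
      by (intro group.group_incl_imp_subgroup[OF grp(1)])
  next
    fix k c assume "c \<in> S (Suc k)"
    then show "boundary I (Suc k) c \<in> S k" using keys_boundary_unmixed by (simp add: S_def)
  next
    fix k e assume "e \<in> carrier (MC X k)" "k = 0 \<or> boundary I k e \<in> S (k - 1)"
    then have "Poly_Mapping.keys e \<subseteq> k_paths X k"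
      "k = 0 \<or> Poly_Mapping.keys (boundary I k e) \<subseteq> unmixed (k - 1)"
      by (simp_all add: MC_def S_def)
    from unmixed_modulo_boundary[OF complex this]
    obtain g where "Poly_Mapping.keys g \<subseteq> k_paths X (Suc k)"
      "Poly_Mapping.keys (e - boundary I (Suc k) g) \<subseteq> unmixed k"
      by blast
    then show "\<exists>g\<in>carrier (MC X (Suc k)). \<exists>m\<in>S k. e = boundary I (Suc k) g \<otimes>\<^bsub>MC X k\<^esub> m"
      by (intro bexI[of _ g] bexI[of _ "e - boundary I (Suc k) g"]) (auto simp: MC_def S_def)
  qed
qed

end
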